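(* Let $r\in(0,1)$ be fixed and let the integer $d$ tend to infinity. If $r\in(0,1/4]$, then $N(r,d)=\Theta(\log d)$; otherwise (that is, if $r\in(1/4,1)$), $N(r,d)=O(1)$. Here the implied constants may depend on $r$ but not on $d$.
   Context: For an integer $d\ge 2$, let $\mathscr{B}_d$ be the family of all open axis-parallel boxes $B=I_1\times\cdots\times I_d\subseteq[0,1]^d$, where each $I_i$ is an open interval; the volume is $\operatorname{vol}(B)=|I_1|\cdots|I_d|$, where $|I_i|$ is the length of $I_i$. For a finite set $T\subset[0,1]^d$, the dispersion of $T$ is \[\operatorname{disp}(T)=\sup_{B\in\mathscr{B}_d,\ B\cap T=\emptyset}\operatorname{vol}(B).\] The minimal dispersion is \[\operatorname{disp}^*(n,d)=\inf_{T\subset[0,1]^d,\ |T|=n}\operatorname{disp}(T),\] and for $r\in(0,1)$ its inverse function is \[N(r,d)=\min\{n\in\mathbb{N}:\operatorname{disp}^*(n,d)\leq r\}.\] *)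

theory Defs
  imports Complex_Main "HOL-Library.FuncSet" "HOL-Library.Landau_Symbols"
begin

(* Points of dimension d are extensional functions on {..<d}, so that equality and cardinality of
   sets of points are those of d-tuples. *)

definition unit_cube :: "nat \<Rightarrow> (nat \<Rightarrow> real) set" where
  "unit_cube d = {..<d} \<rightarrow>\<^sub>E {0..1}"

definition open_box :: "nat \<Rightarrow> (nat \<Rightarrow> real) \<Rightarrow> (nat \<Rightarrow> real) \<Rightarrow> (nat \<Rightarrow> real) set" where
  "open_box d a b = (\<Pi>\<^sub>E i\<in>{..<d}. {a i<..<b i})"

definition disp :: "nat \<Rightarrow> (nat \<Rightarrow> real) set \<Rightarrow> real" where
  "disp d T = Sup {\<Prod>i<d. b i - a i | a b.
     (\<forall>i<d. 0 \<le> a i \<and> a i < b i \<and> b i \<le> 1) \<and> open_box d a b \<inter> T = {}}"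

definition min_disp :: "nat \<Rightarrow> nat \<Rightarrow> real" where
  "min_disp n d = Inf {disp d T | T. T \<subseteq> unit_cube d \<and> finite T \<and> card T = n}"

definition inv_disp :: "real \<Rightarrow> nat \<Rightarrow> nat" where
  "inv_disp r d = (LEAST n. min_disp n d \<le> r)"

(* The minimum defining inv_disp exists: an open box missing the grid of mesh 1/m has a side of
   length at most 1/m. For d > 0, the sets under Sup and Inf above are
   nonempty and bounded. *)

lemma disp_set_nonempty:
  assumes "finite T" "d > 0"
  shows "\<exists>a b. (\<forall>i<d. 0 \<le> a i \<and> a i < b i \<and> b i \<le> (1::real)) \<and> open_box d a b \<inter> T = {}"
proof -
  define A where "A = insert 1 ((\<lambda>x. x 0) ` T \<inter> {0<..})"
  have fin: "finite A" "A \<noteq> {}" using assms by (auto simp: A_def)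
  define c where "c = Min A"
  have c: "c \<in> A" "\<And>y. y \<in> A \<Longrightarrow> c \<le> y" using fin by (auto simp: c_def)
  have "0 < c" "c \<le> 1" using c by (auto simp: A_def)
  moreover have "open_box d (\<lambda>_. 0) (\<lambda>_. c) \<inter> T = {}"
  proof (rule ccontr)
    assume "open_box d (\<lambda>_. 0) (\<lambda>_. c) \<inter> T \<noteq> {}"
    then obtain x where x: "x \<in> open_box d (\<lambda>_. 0) (\<lambda>_. c)" "x \<in> T" by blast
    then have "0 < x 0" "x 0 < c" using assms(2) by (auto simp: open_box_def PiE_iff)
    then show False using c(2)[of "x 0"] x(2) by (auto simp: A_def)
  qed
  ultimately show ?thesis by (intro exI[of _ "\<lambda>_. 0"] exI[of _ "\<lambda>_. c"]) auto
qed

lemma disp_nonneg: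
  assumes "finite T" "d > 0"
  shows "0 \<le> disp d T"
proof -
  obtain a b :: "nat \<Rightarrow> real"
    where ab: "\<forall>i<d. 0 \<le> a i \<and> a i < b i \<and> b i \<le> 1" "open_box d a b \<inter> T = {}"
    using disp_set_nonempty[OF assms] by blast
  let ?S = "{\<Prod>i<d. b i - a i | a b.
     (\<forall>i<d. 0 \<le> a i \<and> a i < b i \<and> b i \<le> 1) \<and> open_box d a b \<inter> T = {}}"
  have bdd: "bdd_above ?S"
  proof (rule bdd_aboveI[of _ 1])
    fix v assume "v \<in> ?S"
    then obtain a b :: "nat \<Rightarrow> real"
      where "v = (\<Prod>i<d. b i - a i)" "\<forall>i<d. 0 \<le> a i \<and> a i < b i \<and> b i \<le> 1" by blast
    then show "v \<le> 1" by (force intro!: prod_le_1)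
  qed
  have "0 \<le> (\<Prod>i<d. b i - a i)" using ab(1) by (force intro!: prod_nonneg)
  also have "\<dots> \<le> Sup ?S" by (rule cSup_upper[OF _ bdd]) (use ab in blast)
  finally show ?thesis by (simp add: disp_def)
qed

lemma disp_grid_le:
  assumes "m > 0" "d > 0"
  shows "disp d ({..<d} \<rightarrow>\<^sub>E (\<lambda>k. real k / real m) ` {..m}) \<le> 1 / real m"
proof -
  let ?T = "{..<d} \<rightarrow>\<^sub>E (\<lambda>k. real k / real m) ` {..m}"
  have "finite ?T" by (intro finite_PiE) auto
  show ?thesis unfolding disp_def
  proof (rule cSup_least)
    show "{\<Prod>i<d. b i - a i | a b.
      (\<forall>i<d. 0 \<le> a i \<and> a i < b i \<and> b i \<le> 1) \<and> open_box d a b \<inter> ?T = {}} \<noteq> {}"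
      using disp_set_nonempty[OF \<open>finite ?T\<close> assms(2)] by blast
  next
    fix v assume "v \<in> {\<Prod>i<d. b i - a i | a b.
      (\<forall>i<d. 0 \<le> a i \<and> a i < b i \<and> b i \<le> 1) \<and> open_box d a b \<inter> ?T = {}}"
    then obtain a b :: "nat \<Rightarrow> real" where v: "v = (\<Prod>i<d. b i - a i)"
      and ab: "\<forall>i<d. 0 \<le> a i \<and> a i < b i \<and> b i \<le> 1" and dis: "open_box d a b \<inter> ?T = {}"
      by blast
    have "\<exists>i<d. b i - a i \<le> 1 / real m"
    proof (rule ccontr)
      assume "\<not> ?thesis"
      then have big: "\<And>i. i < d \<Longrightarrow> b i - a i > 1 / real m" by force
      define k where "k i = nat (\<lfloor>a i * real m\<rfloor> + 1)" for i
      have k: "a i < real (k i) / real m \<and> real (k i) / real m < b i \<and> k i \<le> m" if "i < d" for i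
      proof -
        have a0: "0 \<le> a i * real m" using ab that by simp
        have kr: "real (k i) = of_int (\<lfloor>a i * real m\<rfloor> + 1)" using a0 by (simp add: k_def)
        have 1: "a i * real m < real (k i)" "real (k i) \<le> a i * real m + 1"
          unfolding kr by linarith+
        have 2: "a i * real m + 1 < b i * real m"
          using big[OF that] assms(1) by (simp add: field_simps)
        have "b i * real m \<le> 1 * real m" using ab that by (intro mult_right_mono) auto
        then have "k i \<le> m" using 1 2 by linarith
        then show ?thesis using 1 2 assms(1) by (simp add: field_simps)
      qed
      define x where "x = restrict (\<lambda>i. real (k i) / real m) {..<d}"
      have "x \<in> open_box d a b \<inter> ?T" using k by (auto simp: x_def open_box_def)
      then show False using dis by blast
    qed
    then obtain i where i: "i < d" "b i - a i \<le> 1 / real m" by blast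
    have "v = (b i - a i) * (\<Prod>j\<in>{..<d} - {i}. b j - a j)"
      unfolding v by (rule prod.remove) (use i in auto)
    also have "\<dots> \<le> (b i - a i) * 1"
      using ab i by (intro mult_left_mono prod_le_1) force+
    finally show "v \<le> 1 / real m" using i by simp
  qed
qed

lemma inv_disp_exists:
  assumes "r > 0" "d > 0"
  shows "\<exists>n. min_disp n d \<le> r"
proof -
  obtain m :: nat where m: "m > 0" "1 / real m < r"
    using assms(1) by (metis inverse_eq_divide reals_Archimedean zero_less_Suc)
  let ?T = "{..<d} \<rightarrow>\<^sub>E (\<lambda>k. real k / real m) ` {..m}"
  have fin: "finite ?T" by (intro finite_PiE) auto
  have sub: "?T \<subseteq> unit_cube d" unfolding unit_cube_def using m(1) by (intro PiE_mono) auto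
  have "min_disp (card ?T) d \<le> disp d ?T" unfolding min_disp_def
  proof (rule cInf_lower)
    show "disp d ?T \<in> {disp d T | T. T \<subseteq> unit_cube d \<and> finite T \<and> card T = card ?T}"
      using fin sub by blast
    show "bdd_below {disp d T | T. T \<subseteq> unit_cube d \<and> finite T \<and> card T = card ?T}"
      by (rule bdd_belowI[of _ 0]) (use disp_nonneg assms(2) in auto)
  qed
  also have "\<dots> \<le> r" using disp_grid_le[OF m(1) assms(2)] m(2) by linarith
  finally show ?thesis by blast
qed

end

theory Submission
  imports Defs
begin

text \<open>
  For \<open>r > 1/4\<close>, two sides of a box of volume more than \<open>r\<close> overlap in an interval whose length is
  bounded below in terms of \<open>r\<close>; hence so do all sides together, and equally spaced points on the
  diagonal meet every such box.

  For the upper bound when \<open>r \<le> 1/4\<close>, take points of the grid \<open>{1/m, \<dots>, (m-1)/m}\<^sup>d\<close> with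
  \<open>1/m \<le> r\<close>. In a box of volume more than \<open>r\<close> each side contains a grid value, and all but \<open>S\<close>
  sides (\<open>S\<close> depending on \<open>r\<close> only) contain every grid value. So it is enough that the points realize
  every prescription of values on every \<open>S\<close> coordinates, which \<open>O(log d)\<close> random points do.

  For the lower bound at \<open>r = 1/4\<close>, cut an interval of length \<open>1/N\<close>, where \<open>N = n + 1\<close>, around \<open>1/2\<close>
  into \<open>N\<close> cells. For each coordinate, some cell \<open>(\<alpha>, \<beta>)\<close> contains no coordinate of the \<open>n\<close>
  points. If \<open>d > N 2\<^sup>n\<close>, two coordinates \<open>i \<noteq> j\<close> share the cell and the set of points to its left, so
  the box \<open>x\<^sub>i < \<beta>, x\<^sub>j > \<alpha>\<close> is empty. The cell is so close to \<open>1/2\<close>, compared to its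
  length, that \<open>\<beta> (1 - \<alpha>)\<close> exceeds \<open>1/4\<close> by an amount depending on \<open>n\<close> only.
\<close>

section \<open>Estimating dispersion through boxes, and its inverse through point sets\<close>

lemma disp_leI:
  assumes "finite T" "d > 0"
    and hit: "\<And>a b. \<forall>i<d. 0 \<le> a i \<and> a i < b i \<and> b i \<le> 1 \<Longrightarrow> r < (\<Prod>i<d. b i - a i)
      \<Longrightarrow> open_box d a b \<inter> T \<noteq> {}"
  shows "disp d T \<le> r"
  unfolding disp_def
proof (rule cSup_least)
  show "{\<Prod>i<d. b i - a i | a b.
      (\<forall>i<d. 0 \<le> a i \<and> a i < b i \<and> b i \<le> 1) \<and> open_box d a b \<inter> T = {}} \<noteq> {}"
    using disp_set_nonempty[OF assms(1,2)] by blast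
next
  fix v assume "v \<in> {\<Prod>i<d. b i - a i | a b.
      (\<forall>i<d. 0 \<le> a i \<and> a i < b i \<and> b i \<le> 1) \<and> open_box d a b \<inter> T = {}}"
  then show "v \<le> r" using hit by (smt (verit) mem_Collect_eq)
qed

lemma volume_le_disp:
  assumes "\<forall>i<d. 0 \<le> a i \<and> a i < b i \<and> b i \<le> 1" "open_box d a b \<inter> T = {}"
  shows "(\<Prod>i<d. b i - a i) \<le> disp d T"
  unfolding disp_def
proof (rule cSup_upper)
  show "bdd_above {\<Prod>i<d. b i - a i | a b.
      (\<forall>i<d. 0 \<le> a i \<and> a i < b i \<and> b i \<le> 1) \<and> open_box d a b \<inter> T = {}}"
  proof (rule bdd_aboveI[of _ 1])
    fix v assume "v \<in> {\<Prod>i<d. b i - a i | a b.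
      (\<forall>i<d. 0 \<le> a i \<and> a i < b i \<and> b i \<le> 1) \<and> open_box d a b \<inter> T = {}}"
    then obtain a b :: "nat \<Rightarrow> real"
      where "v = (\<Prod>i<d. b i - a i)" "\<forall>i<d. 0 \<le> a i \<and> a i < b i \<and> b i \<le> 1" by blast
    then show "v \<le> 1" by (force intro!: prod_le_1)
  qed
qed (use assms in blast)

lemma inv_disp_le_card:
  assumes "T \<subseteq> unit_cube d" "finite T" "d > 0" "disp d T \<le> r"
  shows "inv_disp r d \<le> card T"
proof -
  have "min_disp (card T) d \<le> disp d T" unfolding min_disp_def
  proof (rule cInf_lower)
    show "bdd_below {disp d T' | T'. T' \<subseteq> unit_cube d \<and> finite T' \<and> card T' = card T}"
      by (rule bdd_belowI[of _ 0]) (use disp_nonneg assms(3) in auto)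
  qed (use assms in blast)
  then show ?thesis unfolding inv_disp_def using assms(4) by (intro Least_le) linarith
qed

text \<open>The sides outside \<open>J\<close> have length at most 1. Used with one side, with a
  pair of sides and with the set of all short sides.\<close>

lemma volume_le_prod_sides:
  fixes a b :: "nat \<Rightarrow> real"
  assumes "\<forall>i<d. 0 \<le> a i \<and> a i < b i \<and> b i \<le> 1" "J \<subseteq> {..<d}"
  shows "(\<Prod>i<d. b i - a i) \<le> (\<Prod>i\<in>J. b i - a i)"
proof -
  have "(\<Prod>i<d. b i - a i) = (\<Prod>i\<in>{..<d} - J. b i - a i) * (\<Prod>i\<in>J. b i - a i)"
    by (rule prod.subset_diff) (use assms in auto)
  also have "\<dots> \<le> 1 * (\<Prod>i\<in>J. b i - a i)"
  proof (intro mult_right_mono prod_le_1 prod_nonneg)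
    show "\<And>i. i \<in> J \<Longrightarrow> 0 \<le> b i - a i" using assms by force
    show "\<And>i. i \<in> {..<d} - J \<Longrightarrow> 0 \<le> b i - a i \<and> b i - a i \<le> 1" using assms by force
  qed
  finally show ?thesis by simp
qed

lemma exists_grid_point:
  fixes a b :: real
  assumes "0 \<le> a" "b \<le> 1" "1 / real m < b - a" "m > 0"
  obtains k where "k \<in> {1..<m}" "a < real k / real m" "real k / real m < b"
proof
  \<comment> \<open>The first grid index strictly to the right of \<open>a\<close>; floor rather
    than ceiling, since \<open>a\<close> itself may lie on the grid.\<close>
  define k where "k = nat (\<lfloor>a * real m\<rfloor> + 1)"
  have a0: "0 \<le> a * real m" using assms by simp
  have kr: "real k = of_int (\<lfloor>a * real m\<rfloor> + 1)" using a0 by (simp add: k_def)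
  have 1: "a * real m < real k" "real k \<le> a * real m + 1"
    unfolding kr by linarith+
  have 2: "a * real m + 1 < b * real m"
    using assms by (simp add: field_simps)
  have "b * real m \<le> 1 * real m" using assms by (intro mult_right_mono) auto
  then show "k \<in> {1..<m}" using 1 2 a0 by auto
  show "a < real k / real m" "real k / real m < b"
    using 1 2 assms by (simp_all add: field_simps)
qed

subsection \<open>Volumes above one quarter\<close>

text \<open>By the inequality of arithmetic and geometric means, two sides of a box of volume above
  \<open>r\<close> have total length above \<open>2 * sqrt r\<close>. Both lie in the unit interval,
  so they overlap in length more than \<open>2 * sqrt r - 1\<close>, which is positive because
  \<open>r > 1/4\<close>.\<close>

lemma inv_disp_bounded:
  assumes "1/4 < r"
  obtains C where "\<And>d. d > 0 \<Longrightarrow> inv_disp r d \<le> C"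
proof -
  have "1 < 2 * sqrt r" using assms real_sqrt_less_mono[OF assms] by (simp add: real_sqrt_divide)
  then obtain m :: nat where m: "m > 0" "1 / real m < 2 * sqrt r - 1"
    by (metis diff_gt_0_iff_gt inverse_eq_divide reals_Archimedean zero_less_Suc)
  have "inv_disp r d \<le> m" if "d > 0" for d
  proof -
    define P where "P k = restrict (\<lambda>i::nat. real k / real m) {..<d}" for k
    define T where "T = P ` {1..<m}"
    have "disp d T \<le> r"
    proof (rule disp_leI)
      fix a b :: "nat \<Rightarrow> real"
      assume ab: "\<forall>i<d. 0 \<le> a i \<and> a i < b i \<and> b i \<le> 1" and vol: "r < (\<Prod>i<d. b i - a i)"
      have overlap: "1 / real m < b j - a i" if ij: "i < d" "j < d" for i j
      proof (cases "i = j")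
        case True
        have "r < b i - a i" using volume_le_prod_sides[OF ab, of "{i}"] vol ij by simp
        moreover have "b i - a i \<le> 1" using ab ij by force
        moreover have "sqrt r ^ 2 = r" using assms by simp
        \<comment> \<open>A single side is longer than \<open>r\<close>, and this square gives
          \<open>r \<ge> 2 * sqrt r - 1\<close>.\<close>
        moreover have "0 \<le> (sqrt r - 1)^2" by simp
        ultimately show ?thesis using m(2) True by (simp add: power2_eq_square algebra_simps)
      next
        case False
        define x where "x = b i - a i"
        define y where "y = b j - a j"
        have "r < x * y"
          using volume_le_prod_sides[OF ab, of "{i, j}"] vol ij False by (simp add: x_def y_def)
        also have "x * y \<le> ((x + y) / 2)^2"
          using zero_le_power2[of "x - y"] by (simp add: power2_eq_square field_simps)
        finally have "r < ((x + y) / 2)^2" .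
        moreover have "0 \<le> (x + y) / 2"
          using ab[rule_format, OF ij(1)] ab[rule_format, OF ij(2)] by (simp add: x_def y_def)
        ultimately have "sqrt r < (x + y) / 2" by (intro real_less_lsqrt)
        moreover have "0 \<le> a j" "b i \<le> 1" using ab ij by auto
        ultimately show ?thesis using m(2) unfolding x_def y_def by argo
      qed
      have fin: "finite (a ` {..<d})" "a ` {..<d} \<noteq> {}" "finite (b ` {..<d})" "b ` {..<d} \<noteq> {}"
        using \<open>d > 0\<close> by auto
      \<comment> \<open>All sides intersect in \<open>(A, B)\<close>. Both ends are attained, so the
        pairwise estimate bounds \<open>B - A\<close>.\<close>
      define A where "A = Max (a ` {..<d})"
      define B where "B = Min (b ` {..<d})"
      obtain i where i: "i < d" "A = a i" using Max_in[OF fin(1,2)] by (auto simp: A_def)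
      obtain j where j: "j < d" "B = b j" using Min_in[OF fin(3,4)] by (auto simp: B_def)
      obtain k where k: "k \<in> {1..<m}" "A < real k / real m" "real k / real m < B"
        by (rule exists_grid_point[of A B m]) (use i j ab overlap[OF i(1) j(1)] m in auto)
      have "a l \<le> A" "B \<le> b l" if "l < d" for l
        using that fin by (auto simp: A_def B_def)
      then have "P k \<in> open_box d a b"
        using k unfolding P_def open_box_def by (force simp: PiE_iff)
      then show "open_box d a b \<inter> T \<noteq> {}" using k by (auto simp: T_def)
    qed (use that in \<open>auto simp: T_def\<close>)
    moreover have "P k \<in> unit_cube d" if "k \<in> {1..<m}" for k
      using that unfolding P_def unit_cube_def by (simp add: restrict_PiE_iff)
    then have "T \<subseteq> unit_cube d" by (auto simp: T_def)
    ultimately have "inv_disp r d \<le> card T"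
      using that by (intro inv_disp_le_card) (auto simp: T_def)
    also have "card T \<le> m"
      unfolding T_def by (rule order.trans[OF card_image_le]) auto
    finally show ?thesis .
  qed
  then show ?thesis by (rule that)
qed

subsection \<open>The logarithmic upper bound\<close>

text \<open>Union bound: the sequences in \<open>X\<^sup>n\<close> that miss some \<open>A c\<close> do not exhaust \<open>X\<^sup>n\<close>.\<close>
lemma exists_small_hitting_set:
  fixes p :: real
  assumes "finite X" "X \<noteq> {}" "finite C" "p \<le> 1"
    and A: "\<And>c. c \<in> C \<Longrightarrow> A c \<subseteq> X \<and> p * card X \<le> card (A c)"
    and small: "card C * (1 - p) ^ n < 1"
  obtains T where "T \<subseteq> X" "finite T" "card T \<le> n" "\<And>c. c \<in> C \<Longrightarrow> T \<inter> A c \<noteq> {}"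
proof -
  have X: "real (card X) > 0" using assms by (simp add: card_gt_0_iff)
  have "\<exists>f \<in> {..<n} \<rightarrow>\<^sub>E X. \<forall>c\<in>C. \<exists>i<n. f i \<in> A c"
  proof (rule ccontr)
    assume neg: "\<not> ?thesis"
    have "({..<n} \<rightarrow>\<^sub>E X) \<subseteq> (\<Union>c\<in>C. {..<n} \<rightarrow>\<^sub>E (X - A c))"
    proof
      fix f assume f: "f \<in> {..<n} \<rightarrow>\<^sub>E X"
      then obtain c where "c \<in> C" "\<forall>i<n. f i \<notin> A c" using neg by blast
      then show "f \<in> (\<Union>c\<in>C. {..<n} \<rightarrow>\<^sub>E (X - A c))" using f by (auto simp: PiE_iff)
    qed
    then have "card ({..<n} \<rightarrow>\<^sub>E X) \<le> card (\<Union>c\<in>C. {..<n} \<rightarrow>\<^sub>E (X - A c))"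
      by (rule card_mono[rotated]) (use assms in \<open>auto intro!: finite_PiE\<close>)
    also have "\<dots> \<le> (\<Sum>c\<in>C. card ({..<n} \<rightarrow>\<^sub>E (X - A c)))"
      by (rule card_UN_le) fact
    finally have "card X ^ n \<le> (\<Sum>c\<in>C. card (X - A c) ^ n)"
      by (simp add: card_PiE)
    then have "real (card X) ^ n \<le> (\<Sum>c\<in>C. real (card (X - A c)) ^ n)"
      by (metis (no_types, lifting) of_nat_le_iff of_nat_power of_nat_sum sum.cong)
    also have "\<dots> \<le> (\<Sum>c\<in>C. ((1 - p) * card X) ^ n)"
    proof (intro sum_mono power_mono)
      fix c assume c: "c \<in> C"
      have "card (X - A c) = card X - card (A c)" "card (A c) \<le> card X"
        using A[OF c] assms(1) by (auto intro: card_Diff_subset card_mono finite_subset)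
      then show "real (card (X - A c)) \<le> (1 - p) * card X"
        using A[OF c] by (simp add: algebra_simps)
    qed auto
    also have "\<dots> = (card C * (1 - p) ^ n) * real (card X) ^ n"
      by (simp add: power_mult_distrib)
    also have "\<dots> < 1 * real (card X) ^ n"
      by (rule mult_strict_right_mono[OF small]) (use X in simp)
    finally show False by simp
  qed
  then obtain f where f: "f \<in> {..<n} \<rightarrow>\<^sub>E X" "\<forall>c\<in>C. \<exists>i<n. f i \<in> A c" by blast
  show ?thesis
  proof (rule that[of "f ` {..<n}"])
    show "f ` {..<n} \<subseteq> X" using f by auto
    show "card (f ` {..<n}) \<le> n" using card_image_le[of "{..<n}" f] by simp
    show "f ` {..<n} \<inter> A c \<noteq> {}" if "c \<in> C" for c using f that by auto
  qed simp
qed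

text \<open>Apply the union bound to the pairs of an \<open>S\<close>-set \<open>J\<close> of
  coordinates and a pattern on \<open>J\<close>. There are at most \<open>(d * card Q) ^ S\<close>
  of them, and each pattern is realized by a fraction \<open>1 / card Q ^ S\<close> of all
  points.\<close>

lemma exists_covering_array:
  fixes Q :: "'a set"
  assumes "finite Q" "Q \<noteq> {}" "S \<le> d"
    and small: "(real d * real (card Q)) ^ S * (1 - 1 / real (card Q) ^ S) ^ n < 1"
  obtains T where "T \<subseteq> {..<d} \<rightarrow>\<^sub>E Q" "finite T" "card T \<le> n"
    "\<And>J v. J \<subseteq> {..<d} \<Longrightarrow> card J \<le> S \<Longrightarrow> v \<in> {..<d} \<rightarrow> Q \<Longrightarrow> \<exists>x\<in>T. \<forall>j\<in>J. x j = v j"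
proof -
  define q where "q = card Q"
  have q: "q > 0" using assms by (simp add: q_def card_gt_0_iff)
  define X where "X = ({..<d} \<rightarrow>\<^sub>E Q)"
  define Js where "Js = {J. J \<subseteq> {..<d} \<and> card J = S}"
  define C where "C = Sigma Js (\<lambda>J. J \<rightarrow>\<^sub>E Q)"
  define A where "A = (\<lambda>(J, v). {x \<in> X. \<forall>j\<in>J. x j = v j})"
  have finJs: "finite Js" unfolding Js_def by simp
  have finJ: "finite J" if "J \<in> Js" for J using that finite_subset by (auto simp: Js_def)
  have finX: "finite X" unfolding X_def using assms by (intro finite_PiE) auto
  have cX: "card X = q ^ d" by (simp add: X_def card_PiE q_def)
  have "X \<noteq> {}" using cX q finX by (metis card.empty power_not_zero not_gr_zero)
  have finC: "finite C" unfolding C_def using finJs finJ assms by (auto intro!: finite_PiE)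
  have "card C = (\<Sum>J\<in>Js. card (J \<rightarrow>\<^sub>E Q))"
    unfolding C_def using finJs finJ assms by (intro card_SigmaI) (auto intro!: finite_PiE)
  also have "\<dots> = (\<Sum>J\<in>Js. q ^ S)"
  proof (rule sum.cong)
    fix J assume J: "J \<in> Js"
    then have "card J = S" by (simp add: Js_def)
    then show "card (J \<rightarrow>\<^sub>E Q) = q ^ S" using finJ[OF J] by (simp add: card_PiE q_def)
  qed simp
  also have "\<dots> = (d choose S) * q ^ S" by (simp add: Js_def n_subsets)
  also have "\<dots> \<le> d ^ S * q ^ S" by (intro mult_right_mono binomial_le_pow assms) simp
  finally have "card C \<le> (d * q) ^ S" by (simp add: power_mult_distrib)
  then have cC: "real (card C) \<le> (real d * real q) ^ S"
    by (metis of_nat_le_iff of_nat_mult of_nat_power)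
  have p: "1 / real q ^ S \<le> 1" using q by (simp add: field_simps)
  have cA: "A c \<subseteq> X \<and> 1 / real q ^ S * card X \<le> card (A c)" if c: "c \<in> C" for c
  proof -
    obtain J v where Jv: "c = (J, v)" "J \<subseteq> {..<d}" "card J = S" "v \<in> J \<rightarrow>\<^sub>E Q"
      using c by (auto simp: C_def Js_def)
    \<comment> \<open>As a product set, \<open>A c\<close> can be counted coordinate by
      coordinate.\<close>
    have "A c = (\<Pi>\<^sub>E i\<in>{..<d}. if i \<in> J then {v i} else Q)"
    proof (intro set_eqI iffI)
      fix x assume "x \<in> A c"
      then show "x \<in> (\<Pi>\<^sub>E i\<in>{..<d}. if i \<in> J then {v i} else Q)"
        using Jv(1) by (simp add: A_def X_def PiE_iff)
    next
      fix x assume x: "x \<in> (\<Pi>\<^sub>E i\<in>{..<d}. if i \<in> J then {v i} else Q)"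
      then have eq: "x j = v j" if "j \<in> J" for j using that Jv(2) by (force simp: PiE_iff)
      have "x i \<in> Q" if "i < d" for i
      proof (cases "i \<in> J")
        case True
        then show ?thesis using eq Jv(4) by auto
      next
        case False
        then show ?thesis using x that by (force simp: PiE_iff)
      qed
      then show "x \<in> A c" using x eq Jv(1) by (simp add: A_def X_def PiE_iff)
    qed
    then have "card (A c) = (\<Prod>i<d. if i \<in> J then 1 else q)"
      by (simp add: card_PiE q_def if_distrib cong: if_cong)
    also have "\<dots> = (\<Prod>i\<in>{..<d} - J. q)"
      by (rule prod.mono_neutral_cong_right) auto
    also have "\<dots> = q ^ (d - S)" using Jv finite_subset[OF Jv(2)] by (simp add: card_Diff_subset)
    finally have "real (card (A c)) = real q ^ (d - S)" by simp
    moreover have "real q ^ d = real q ^ (d - S) * real q ^ S"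
      using assms(3) by (simp flip: power_add)
    ultimately show ?thesis using q by (auto simp: A_def Jv(1) cX)
  qed
  have "card C * (1 - 1 / real q ^ S) ^ n \<le> (real d * real q) ^ S * (1 - 1 / real q ^ S) ^ n"
    using p by (intro mult_right_mono cC) auto
  also have "\<dots> < 1" using small by (simp add: q_def)
  finally have "card C * (1 - 1 / real q ^ S) ^ n < 1" .
  then obtain T where T: "T \<subseteq> X" "finite T" "card T \<le> n" "\<And>c. c \<in> C \<Longrightarrow> T \<inter> A c \<noteq> {}"
    using exists_small_hitting_set[where A = A, OF finX \<open>X \<noteq> {}\<close> finC p cA, where n = n]
    by metis
  show ?thesis
  proof (rule that[of T])
    show "T \<subseteq> {..<d} \<rightarrow>\<^sub>E Q" using T(1) by (simp add: X_def)
    fix J and v :: "nat \<Rightarrow> 'a"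
    assume J: "J \<subseteq> {..<d}" "card J \<le> S" and v: "v \<in> {..<d} \<rightarrow> Q"
    \<comment> \<open>The union bound treats sets of size exactly \<open>S\<close>; a smaller
      \<open>J\<close> is enlarged, which \<open>S \<le> d\<close> permits.\<close>
    obtain J' where J': "J \<subseteq> J'" "J' \<subseteq> {..<d}" "card J' = S"
      using exists_subset_between[of J S "{..<d}"] J assms(3) by auto
    have "(J', restrict v J') \<in> C" using J' v by (auto simp: C_def Js_def)
    from T(4)[OF this] obtain x where "x \<in> T" "\<forall>j\<in>J'. x j = restrict v J' j"
      by (auto simp: A_def)
    then show "\<exists>x\<in>T. \<forall>j\<in>J. x j = v j" using J'(1) by (auto intro!: bexI[of _ x])
  qed (use T in auto)
qed

lemma inv_disp_le_log:
  assumes "0 < r" "r < 1"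
  obtains C where "C > 0" "\<forall>\<^sub>F d in sequentially. real (inv_disp r d) \<le> C * ln (real d)"
proof -
  obtain m :: nat where m: "m > 0" "1 / real m < r"
    using assms(1) by (metis inverse_eq_divide reals_Archimedean zero_less_Suc)
  have m2: "m \<ge> 2" using m assms by (cases "m = 1") auto
  define q where "q = m - 1"
  have q: "q > 0" using m2 by (simp add: q_def)
  \<comment> \<open>With this \<open>S\<close>, a box of volume above \<open>r\<close> has fewer
    than \<open>S\<close> sides of length at most \<open>1 - 1/m\<close>.\<close>
  obtain S where S: "(1 - 1 / real m) ^ S < r"
    using real_arch_pow_inv[of r "1 - 1 / real m"] assms m by auto
  define K where "K = real S * real q ^ S"
  have bound: "real (inv_disp r d) \<le> K * ln (real d * real q) + 1"
    if d: "d \<ge> S" "d > 0" for d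
  proof -
    \<comment> \<open>By \<open>1 - x \<le> exp (- x)\<close>, the covering condition follows from
      \<open>S * ln (d * q) < n / q ^ S\<close>, that is, from \<open>n > K * ln (d * q)\<close>.
      The inequality is strict, hence floor plus one.\<close>
    define n where "n = nat (\<lfloor>K * ln (real d * real q)\<rfloor> + 1)"
    have dq: "real d * real q \<ge> 1" using d q
      by (metis Suc_leI less_numeral_extra(1) mult_pos_pos of_nat_1 of_nat_le_iff of_nat_mult One_nat_def)
    then have nn: "0 \<le> K * ln (real d * real q)" by (simp add: K_def)
    then have "real n = of_int (\<lfloor>K * ln (real d * real q)\<rfloor> + 1)"
      by (simp add: n_def)
    then have n: "K * ln (real d * real q) < real n" "real n \<le> K * ln (real d * real q) + 1"
      by linarith+
    have qS: "real q ^ S \<ge> 1" using q by (simp add: Suc_leI)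
    have "(1 - 1 / real q ^ S) ^ n \<le> exp (- 1 / real q ^ S) ^ n"
    proof (rule power_mono)
      show "1 - 1 / real q ^ S \<le> exp (- 1 / real q ^ S)"
        using exp_ge_add_one_self[of "- 1 / real q ^ S"] by simp
      show "0 \<le> 1 - 1 / real q ^ S" using qS q by (simp add: field_simps)
    qed
    also have "\<dots> = exp (- real n / real q ^ S)" by (simp flip: exp_of_nat_mult)
    finally have "(real d * real q) ^ S * (1 - 1 / real q ^ S) ^ n
        \<le> (real d * real q) ^ S * exp (- real n / real q ^ S)"
      using dq by (intro mult_left_mono) auto
    also have "\<dots> = exp (real S * ln (real d * real q)) * exp (- real n / real q ^ S)"
      using dq by (simp add: exp_of_nat_mult)
    also have "\<dots> = exp (real S * ln (real d * real q) - real n / real q ^ S)"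
      by (simp flip: exp_add)
    also have "\<dots> < 1"
      using n(1) qS q by (simp add: K_def field_simps)
    finally have small: "(real d * real q) ^ S * (1 - 1 / real q ^ S) ^ n < 1" .
    \<comment> \<open>The values 0 and 1 are left out, so that every side longer than
      \<open>1 - 1/m\<close> contains all of \<open>Q\<close>.\<close>
    define Q where "Q = (\<lambda>k. real k / real m) ` {1..<m}"
    have cQ: "card Q = q" unfolding Q_def q_def
      by (subst card_image) (use m in \<open>auto simp: inj_on_def\<close>)
    have "card Q \<noteq> 0" using cQ q by simp
    then have "Q \<noteq> {}" by (metis card.empty)
    have "finite Q" by (simp add: Q_def)
    obtain T where T: "T \<subseteq> {..<d} \<rightarrow>\<^sub>E Q" "finite T" "card T \<le> n"
      "\<And>J v. J \<subseteq> {..<d} \<Longrightarrow> card J \<le> S \<Longrightarrow> v \<in> {..<d} \<rightarrow> Q \<Longrightarrow> \<exists>x\<in>T. \<forall>j\<in>J. x j = v j"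
      using exists_covering_array[OF \<open>finite Q\<close> \<open>Q \<noteq> {}\<close> d(1), of n] small by (metis cQ)
    have "Q \<subseteq> {0..1}" by (auto simp: Q_def)
    then have sub: "T \<subseteq> unit_cube d"
      using T(1) unfolding unit_cube_def by (meson PiE_mono order_trans)
    have "disp d T \<le> r"
    proof (rule disp_leI)
      fix a b :: "nat \<Rightarrow> real"
      assume ab: "\<forall>i<d. 0 \<le> a i \<and> a i < b i \<and> b i \<le> 1" and vol: "r < (\<Prod>i<d. b i - a i)"
      define J where "J = {i\<in>{..<d}. b i - a i \<le> 1 - 1 / real m}"
      have "J \<subseteq> {..<d}" by (auto simp: J_def)
      then have "r < (\<Prod>i\<in>J. b i - a i)"
        using volume_le_prod_sides[OF ab, of J] vol by simp
      also have "\<dots> \<le> (\<Prod>i\<in>J. 1 - 1 / real m)"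
      proof (rule prod_mono)
        fix i assume "i \<in> J"
        then show "0 \<le> b i - a i \<and> b i - a i \<le> 1 - 1 / real m"
          using ab[rule_format, of i] by (simp add: J_def)
      qed
      finally have "r < (1 - 1 / real m) ^ card J" by simp
      moreover have "(1 - 1 / real m) ^ card J \<le> (1 - 1 / real m) ^ S" if "S \<le> card J"
        using that m2 by (intro power_decreasing) auto
      ultimately have cJ: "card J \<le> S" using S by linarith
      have "\<exists>t\<in>Q. a i < t \<and> t < b i" if "i < d" for i
      proof -
        have "r < b i - a i" using volume_le_prod_sides[OF ab, of "{i}"] vol that by simp
        then show ?thesis
          using exists_grid_point[of "a i" "b i" m] ab that m unfolding Q_def
          by (smt (verit) image_eqI)
      qed
      then obtain v where v: "\<And>i. i < d \<Longrightarrow> v i \<in> Q \<and> a i < v i \<and> v i < b i" by metis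
      obtain x where x: "x \<in> T" "\<forall>j\<in>J. x j = v j"
        using T(4)[of J v] cJ v by (auto simp: J_def)
      have "a i < x i \<and> x i < b i" if i: "i < d" for i
      proof (cases "i \<in> J")
        case True
        then show ?thesis using x v i by auto
      next
        case False
        then have len: "1 - 1 / real m < b i - a i" using i by (auto simp: J_def)
        have "x i \<in> Q" using x T(1) i by auto
        then obtain k where k: "x i = real k / real m" "1 \<le> k" "k + 1 \<le> m"
          by (auto simp: Q_def)
        then have "1 / real m \<le> x i" by (simp add: divide_right_mono)
        moreover have "x i \<le> 1 - 1 / real m" using k m by (simp add: field_simps)
        moreover have "0 \<le> a i" "b i \<le> 1" using ab i by auto
        ultimately show ?thesis using len by linarith
      qed
      then have "x \<in> open_box d a b"
        using x T(1) unfolding open_box_def by (auto simp: PiE_iff)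
      then show "open_box d a b \<inter> T \<noteq> {}" using x by blast
    qed (use T d in auto)
    then have "inv_disp r d \<le> card T" using sub T d by (intro inv_disp_le_card) auto
    then show ?thesis using T(3) n(2) by linarith
  qed
  \<comment> \<open>For \<open>d \<ge> q\<close>, \<open>ln (d * q)\<close> is at most
    \<open>2 * ln d\<close>; for \<open>d \<ge> 3\<close>, the summand 1 is at most
    \<open>ln d\<close>.\<close>
  define C where "C = 2 * K + 1"
  have "K \<ge> 0" by (simp add: K_def)
  then have "C > 0" by (simp add: C_def)
  moreover have "\<forall>\<^sub>F d in sequentially. real (inv_disp r d) \<le> C * ln (real d)"
    using eventually_ge_at_top[of "max 3 (max S q)"]
  proof eventually_elim
    case (elim d)
    then have d: "d \<ge> 3" "d \<ge> S" "d \<ge> q" by auto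
    have "real (inv_disp r d) \<le> K * ln (real d * real q) + 1" using bound d by simp
    moreover have "ln (real d * real q) \<le> 2 * ln (real d)"
      using d q by (simp add: ln_mult)
    then have "K * ln (real d * real q) \<le> K * (2 * ln (real d))"
      using \<open>K \<ge> 0\<close> by (rule mult_left_mono)
    moreover have "1 \<le> ln (real d)"
      using d exp_le ln_mono[of "exp 1" "real d"] by (simp add: ln_ge_iff)
    ultimately show ?case by (simp add: C_def algebra_simps)
  qed
  ultimately show ?thesis by (rule that)
qed

subsection \<open>The logarithmic lower bound\<close>

text \<open>The excess over \<open>1/4\<close> depends on \<open>n\<close> but not on
  \<open>T\<close>, so the strict inequality survives the infimum over all \<open>T\<close>.\<close>

lemma disp_gt_quarter:
  assumes "finite T" "card T = n" and d: "(n + 1) * 2 ^ n < d"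
  shows "1/4 + 1 / (4 * (real n + 1)^2) \<le> disp d T"
proof -
  define N where "N = real n + 1"
  have N: "N \<ge> 1" by (simp add: N_def)
  \<comment> \<open>The endpoints of the cells: each has length \<open>1 / N^2\<close>, and those
    with \<open>k \<le> n\<close> fill the interval of length \<open>1 / N\<close> centred at
    \<open>1/2\<close>.\<close>
  define \<alpha> where "\<alpha> k = 1/2 - 1 / (2 * N) + real k / N^2" for k :: nat
  have mono: "\<alpha> k \<le> \<alpha> l" if "k \<le> l" for k l
    using that by (simp add: \<alpha>_def divide_right_mono)
  have disjoint: "\<not> (\<alpha> l < t \<and> t < \<alpha> (l + 1))" if "\<alpha> k < t" "t < \<alpha> (k + 1)" "k \<noteq> l" for k l t
    using that mono[of "k + 1" l] mono[of "l + 1" k] by (cases "k < l") auto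
  have "\<exists>k\<le>n. \<forall>x\<in>T. \<not> (\<alpha> k < x i \<and> x i < \<alpha> (k + 1))" for i :: nat
  proof (rule ccontr)
    assume "\<not> ?thesis"
    then have "\<forall>k\<in>{..n}. \<exists>x\<in>T. \<alpha> k < x i \<and> x i < \<alpha> (k + 1)" by auto
    then obtain f where f: "\<forall>k\<in>{..n}. f k \<in> T \<and> \<alpha> k < f k i \<and> f k i < \<alpha> (k + 1)" by metis
    \<comment> \<open>One point cannot serve two cells, as its \<open>i\<close>-th coordinate lies
      in at most one; \<open>n + 1\<close> cells would need \<open>n + 1\<close> points.\<close>
    have "inj_on f {..n}" using f disjoint by (metis inj_onI)
    then have "card {..n} \<le> card T" using f assms by (intro card_inj_on_le[of f]) auto
    then show False using assms by simp
  qed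
  then obtain c where c: "\<And>i. c i \<le> n" "\<And>i x. x \<in> T \<Longrightarrow> \<not> (\<alpha> (c i) < x i \<and> x i < \<alpha> (c i + 1))"
    by metis
  \<comment> \<open>This takes at most \<open>(n + 1) * 2 ^ n\<close> values, fewer than there are
    coordinates.\<close>
  define g where "g i = (c i, {x\<in>T. x i \<le> \<alpha> (c i)})" for i
  have "card (g ` {..<d}) \<le> card ({..n} \<times> Pow T)"
    by (rule card_mono) (use assms c in \<open>auto simp: g_def\<close>)
  also have "\<dots> < card {..<d}" using assms by (simp add: card_cartesian_product card_Pow)
  finally obtain i j where ij: "i < d" "j < d" "i \<noteq> j" "g i = g j"
    using pigeonhole[of g "{..<d}"] by (auto simp: inj_on_def)
  define k where "k = c i"
  have k: "k \<le> n" "c j = k" using c ij by (auto simp: k_def g_def)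
  have "{x\<in>T. x i \<le> \<alpha> k} = {x\<in>T. x j \<le> \<alpha> k}"
    using ij(4) k(2) by (simp add: g_def k_def[symmetric])
  then have same: "x i \<le> \<alpha> k \<longleftrightarrow> x j \<le> \<alpha> k" if "x \<in> T" for x
    using that by blast
  define a where "a = (\<lambda>l. if l = j then \<alpha> k else 0)"
  define b where "b = (\<lambda>l. if l = i then \<alpha> (k + 1) else 1)"
  have "1 / (2 * N) \<le> 1/2" using N by (simp add: field_simps)
  moreover have kN: "0 \<le> real k / N^2" "real (k + 1) / N^2 \<le> 1 / N"
  proof -
    have "real (k + 1) / N^2 \<le> N / N^2"
      using k(1) by (intro divide_right_mono) (simp_all add: N_def)
    then show "real (k + 1) / N^2 \<le> 1 / N" using N by (simp add: power2_eq_square)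
  qed simp
  moreover have "1 / N = 2 * (1 / (2 * N))" by simp
  ultimately have \<alpha>: "0 \<le> \<alpha> k" "\<alpha> (k + 1) \<le> 1"
    unfolding \<alpha>_def by linarith+
  have step: "\<alpha> (k + 1) = \<alpha> k + 1 / N^2" by (simp add: \<alpha>_def add_divide_distrib)
  then have "\<alpha> k < \<alpha> (k + 1)" using N by simp
  then have valid: "\<forall>l<d. 0 \<le> a l \<and> a l < b l \<and> b l \<le> 1" using \<alpha> ij(3) by (auto simp: a_def b_def)
  have "open_box d a b \<inter> T = {}"
  proof (rule ccontr)
    assume "open_box d a b \<inter> T \<noteq> {}"
    then obtain x where x: "x \<in> open_box d a b" "x \<in> T" by blast
    have "x i \<in> {a i<..<b i}" "x j \<in> {a j<..<b j}"
      using x(1) ij by (auto simp: open_box_def PiE_iff)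
    then have "x i < \<alpha> (k + 1)" "\<alpha> k < x j" by (auto simp: a_def b_def)
    \<comment> \<open>Since \<open>x i\<close> avoids the cell, it lies at or left of
      \<open>\<alpha> k\<close>; then so does \<open>x j\<close>, against
      \<open>\<alpha> k < x j\<close>.\<close>
    then show False using c(2)[OF x(2), of i] same[OF x(2)] by (auto simp: k_def)
  qed
  note volume_le_disp[OF valid this]
  moreover have "(\<Prod>l<d. b l - a l) = (b i - a i) * (b j - a j)"
  proof -
    have "(\<Prod>l<d. b l - a l) = (\<Prod>l\<in>{i, j}. b l - a l)"
      by (rule prod.mono_neutral_right) (use ij in \<open>auto simp: a_def b_def\<close>)
    then show ?thesis using ij(3) by simp
  qed
  moreover have "(b i - a i) * (b j - a j) = \<alpha> (k + 1) * (1 - \<alpha> k)"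
    using ij(3) by (simp add: a_def b_def)
  moreover have "1/4 + 1 / (4 * N^2) \<le> \<alpha> (k + 1) * (1 - \<alpha> k)"
  proof -
    \<comment> \<open>Half the length of the cell is \<open>w\<close>, and \<open>v\<close> is the
      offset of its midpoint from \<open>1/2\<close>. The volume becomes
      \<open>(1/2 + w)^2 - v^2\<close>, where the loss \<open>v^2\<close> is at most half of the
      gain \<open>w\<close>.\<close>
    define w where "w = 1 / (2 * N^2)"
    define v where "v = \<alpha> k + w - 1/2"
    have "\<bar>v\<bar> \<le> 1 / (2 * N)"
    proof -
      have "v = real k / N^2 + 1 / (2 * N^2) - 1 / (2 * N)"
        by (simp add: v_def \<alpha>_def w_def)
      moreover have "real (k + 1) / N^2 = real k / N^2 + 2 * (1 / (2 * N^2))"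
        by (simp add: add_divide_distrib)
      moreover have "0 \<le> 1 / (2 * N^2)" by simp
      ultimately show ?thesis using kN \<open>1 / N = 2 * (1 / (2 * N))\<close> by linarith
    qed
    then have "v^2 \<le> (1 / (2 * N))^2" by (metis abs_ge_zero power2_abs power_mono)
    also have "\<dots> = w / 2" by (simp add: w_def power2_eq_square)
    finally have v: "v^2 \<le> w / 2" .
    have "\<alpha> k = 1/2 + v - w" "\<alpha> (k + 1) = 1/2 + v + w"
      unfolding step by (simp_all add: v_def w_def)
    then have "\<alpha> (k + 1) * (1 - \<alpha> k) = (1/2 + v + w) * (1 - (1/2 + v - w))" by simp
    also have "\<dots> = 1/4 + w + w^2 - v^2" by (simp add: power2_eq_square algebra_simps)
    finally have "\<alpha> (k + 1) * (1 - \<alpha> k) = 1/4 + w + w^2 - v^2" .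
    then have "1/4 + w / 2 \<le> \<alpha> (k + 1) * (1 - \<alpha> k)"
      using v zero_le_power2[of w] by argo
    then show ?thesis by (simp add: w_def)
  qed
  ultimately show ?thesis by (simp add: N_def)
qed

text \<open>Diagonal points, told apart by coordinate 0. This makes the set under the infimum in
  \<open>min_disp\<close> nonempty.\<close>

lemma exists_point_set:
  assumes "d > 0"
  shows "\<exists>T. T \<subseteq> unit_cube d \<and> finite T \<and> card T = n"
proof -
  define P where "P k = restrict (\<lambda>i::nat. real k / real n) {..<d}" for k
  have "inj_on P {..<n}"
  proof (rule inj_onI)
    fix k l assume kl: "k \<in> {..<n}" "l \<in> {..<n}" "P k = P l"
    from kl(3) have "P k 0 = P l 0" by simp
    then show "k = l" using kl(1,2) assms by (simp add: P_def)
  qed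
  then have "card (P ` {..<n}) = n" by (simp add: card_image)
  moreover have "P k \<in> unit_cube d" if "k \<in> {..<n}" for k
    using that unfolding P_def unit_cube_def by (simp add: restrict_PiE_iff)
  then have "P ` {..<n} \<subseteq> unit_cube d" by auto
  ultimately show ?thesis by blast
qed

lemma min_disp_gt_quarter:
  assumes "(n + 1) * 2 ^ n < d"
  shows "1/4 < min_disp n d"
proof -
  have "1/4 + 1 / (4 * (real n + 1)^2) \<le> min_disp n d"
    unfolding min_disp_def
    by (rule cInf_greatest) (use exists_point_set[of d n] disp_gt_quarter assms in auto)
  moreover have "0 < 1 / (4 * (real n + 1)^2)" by simp
  ultimately show ?thesis by linarith
qed

text \<open>The minimum \<open>n\<close> is attained, so its minimal dispersion is at most
  \<open>1/4\<close>. This forces \<open>d \<le> (n + 1) * 2 ^ n\<close>, which is at most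
  \<open>4 ^ n\<close>.\<close>

lemma inv_disp_ge_log:
  assumes "0 < r" "r \<le> 1/4" "d > 0"
  shows "ln (real d) \<le> 2 * ln 2 * real (inv_disp r d)"
proof -
  define n where "n = inv_disp r d"
  have "min_disp n d \<le> r"
    unfolding n_def inv_disp_def using inv_disp_exists[OF assms(1,3)] by (rule LeastI_ex)
  then have "d \<le> (n + 1) * 2 ^ n" using min_disp_gt_quarter[of n d] assms(2) by force
  also have "\<dots> \<le> 2 ^ n * 2 ^ n"
    using less_exp[of n] by (intro mult_right_mono) (simp_all add: Suc_leI)
  finally have "real d \<le> 2 ^ (2 * n)"
    by (metis mult_2 numeral_power_eq_of_nat_cancel_iff of_nat_le_iff power_add)
  then have "ln (real d) \<le> ln (2 ^ (2 * n))" using assms(3) by (intro ln_mono) auto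
  then show ?thesis by (simp add: ln_realpow n_def algebra_simps)
qed

theorem corollary1:
  fixes r :: real
  assumes "0 < r" and "r < 1"
  shows "(r \<le> 1/4 \<longrightarrow> (\<lambda>d. real (inv_disp r d)) \<in> \<Theta>(\<lambda>d. ln (real d))) \<and>
         (1/4 < r \<longrightarrow> (\<lambda>d. real (inv_disp r d)) \<in> O(\<lambda>d. 1))"
proof (intro conjI impI)
  assume r: "r \<le> 1/4"
  obtain C where C: "C > 0" "\<forall>\<^sub>F d in sequentially. real (inv_disp r d) \<le> C * ln (real d)"
    using inv_disp_le_log[OF assms] by blast
  show "(\<lambda>d. real (inv_disp r d)) \<in> \<Theta>(\<lambda>d. ln (real d))"
  proof (rule bigthetaI)
    show "(\<lambda>d. real (inv_disp r d)) \<in> O(\<lambda>d. ln (real d))"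
      by (rule bigoI[of _ C], rule eventually_mono[OF C(2)])
        (use \<open>C > 0\<close> in \<open>auto intro: order.trans mult_left_mono\<close>)
    have "(\<lambda>d. ln (real d)) \<in> O(\<lambda>d. real (inv_disp r d))"
    proof (rule bigoI[of _ "2 * ln 2"])
      show "\<forall>\<^sub>F d in sequentially. norm (ln (real d)) \<le> 2 * ln 2 * norm (real (inv_disp r d))"
        using eventually_gt_at_top[of 0]
        by eventually_elim (use inv_disp_ge_log[OF assms(1) r] in simp)
    qed
    then show "(\<lambda>d. real (inv_disp r d)) \<in> \<Omega>(\<lambda>d. ln (real d))"
      by (simp add: bigomega_iff_bigo)
  qed
next
  assume "1/4 < r"
  then obtain C where "\<And>d. d > 0 \<Longrightarrow> inv_disp r d \<le> C" using inv_disp_bounded by blast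
  then show "(\<lambda>d. real (inv_disp r d)) \<in> O(\<lambda>d. 1)"
    by (intro bigoI[of _ "real C"] eventually_mono[OF eventually_gt_at_top[of 0]]) simp
qed

end
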